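(* Consider an extensive-form game with player set $P$, chance player $p_c$, set of states $S$, set of terminal states $Z$, and behaviour strategies $\sigma_q$ for all $q\in P\cup\{p_c\}$. Let $P_a\subseteq P\cup\{p_c\}$ be a non-empty set of players, including $p_c$, whose strategies are known, and let $P_o=P\setminus P_a$. Let $\mathcal{H}$ be an admissible partition of the states $h$ with $p(h)\in P_a$, and let $u_h:A'(h)\to\mathbb{R}$ be arbitrary functions, one for each state $h$ with $p(h)\in P_a$. Then the sum of the correction terms $k_H$ has expected value zero: $$\mathop{\mathbb{E}}_{z\in Z}\Big[\sum_{H\in\mathcal{H}}k_H(z)\Big]=0.$$
   Context: **Game.** An extensive-form game consists of a set of players $P$ and a chance player $p_c$; a set $S$ of states, each described as a history of actions from the initial state $\varnothing$; a set $Z\subset S$ of terminal states; an acting-player function $p(\cdot):S\setminus Z\to P\cup\{p_c\}$; player value functions $v_q:Z\to\mathbb{R}$; and information partitions $\mathcal{I}_q$ of $\{h\in S: p(h)=q\}$. Write $h\sqsubset h'$ if a game in state $h'$ was previously in state $h$, and $h\sqsubseteq h'$ if $h\sqsubset h'$ or $h=h'$. $A(h)$ is the set of valid actions at $h$, and $h\cdot a$ is the successor state of $h$ reached by making action $a$. **Strategies and reach probabilities.** A behaviour strategy $\sigma_q(I,a)$ gives the probability of player $q$ choosing $a$ at information set $I\in\mathcal{I}_q$; $\sigma_q(h,a)=\sigma_q(I,a)$ for all $h\in I$. For states $h$ with $p(h)=p_c$, $\sigma_{p_c}(h,\cdot)$ is the publicly known probability distribution over chance outcomes at $h$. Put $\pi(h)=\prod_{h'\cdot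 a\sqsubseteq h}\sigma_{p(h')}(h',a)$ (the probability of reaching $h$), $\pi_q(h)=\prod_{h'\cdot a\sqsubseteq h,\ p(h')=q}\sigma_q(h',a)$, and $\pi_T(h)=\prod_{q\in T}\pi_q(h)$ for any set of players $T$. For a function $f$ on $Z$, $\mathbb{E}_{z\in Z}[f(z)]=\sum_{z\in Z}\pi(z)f(z)$. **Admissible partition $\mathcal{H}$.** A partition $\mathcal{H}$ of $\{h: p(h)\in P_a\}$ is called admissible here if for every $H\in\mathcal{H}$ and all $h,h'\in H$: (1) for every $q\in P_o$ and every $\sigma_q$, $\pi_q(h)=\pi_q(h')$; (2) $h\not\sqsubset h'$ (so for any terminal $z$, the set $\{h''\in H: h''\sqsubset z\}$ is empty or a singleton); (3) the actions are extended so that $A'(h)=\bigcup_{h''\in H}A(h'')$, with $\sigma(h,a)=0$ for all $a\in A'(h)\setminus A(h)$; since $A'(h)=A'(h')$, write $A(H)=A'(h)$. (Thus $\pi_{P_a}(h\cdot a)=\pi_{P_a}(h)\,\sigma_{p(h)}(h,a)$, which is $0$ for $a\in A(H)\setminus A(h)$.) **Correction term $k_H$.** Given $z\in Z$ and $H\in\mathcal{H}$: if there is no $h\in H$ with $h\sqsubset z$, then $k_H(z)=0$. Otherwise, by (2), there is a unique observed action $a_{\mathrm{O}}$ such that $\bar h\cdot a_{\mathrm{O}}\sqsubseteq z$ for some $\bar h\in H$ with $a_{\mathrm{O}}\in A(\bar h)$, and $$k_H(z)=\frac{\sum_{a\in A(H)}\sum_{h\in H}\pi_{P_a}(h\cdot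 a)u_h(a)}{\sum_{h\in H}\pi_{P_a}(h)}-\frac{\sum_{h\in H}\pi_{P_a}(h\cdot a_{\mathrm{O}})u_h(a_{\mathrm{O}})}{\sum_{h\in H}\pi_{P_a}(h\cdot a_{\mathrm{O}})}.$$ *)

theory Defs
  imports Complex_Main "HOL-Library.Sublist" "HOL-Library.Disjoint_Sets"
begin

text \<open>
  A state is identified with its history, a list of actions read from the initial
  state \<^term>\<open>[]\<close>.  Hence the successor of \<open>h\<close> under \<open>a\<close> is \<open>h @ [a]\<close>, and the relations
  ``was previously in state'' and its reflexive closure are \<^const>\<open>strict_prefix\<close> and
  \<^const>\<open>prefix\<close>.
\<close>

record ('p, 'a) game =
  players :: "'p set"
  chance :: 'p
  states :: "'a list set"
  actor :: "'a list \<Rightarrow> 'p"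
  payoff :: "'p \<Rightarrow> 'a list \<Rightarrow> real"
  info :: "'p \<Rightarrow> 'a list set set"
  chance_prob :: "'a list \<Rightarrow> 'a \<Rightarrow> real"

definition actions :: "('p, 'a) game \<Rightarrow> 'a list \<Rightarrow> 'a set" where
  "actions G h = {a. h @ [a] \<in> states G}"

definition terminals :: "('p, 'a) game \<Rightarrow> 'a list set" where
  "terminals G = {h \<in> states G. actions G h = {}}"

definition decision_states :: "('p, 'a) game \<Rightarrow> 'p set \<Rightarrow> 'a list set" where
  "decision_states G T = {h \<in> states G - terminals G. actor G h \<in> T}"

text \<open>Finiteness is what makes the expectations and the products over players
  below ordinary finite sums and products.\<close>

locale extensive_form_game =
  fixes G :: "('p, 'a) game"
  assumes finite_players: "finite (players G)"
    and chance_not_player: "chance G \<notin> players G"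
    and finite_states: "finite (states G)"
    and initial_state: "[] \<in> states G"
    and prefix_closed: "\<And>h a. h @ [a] \<in> states G \<Longrightarrow> h \<in> states G"
    and actor_mem: "\<And>h. h \<in> states G - terminals G \<Longrightarrow> actor G h \<in> insert (chance G) (players G)"
    and info_partition: "\<And>q. q \<in> players G \<Longrightarrow> partition_on (decision_states G {q}) (info G q)"
    and chance_nonneg: "\<And>h a. h \<in> decision_states G {chance G} \<Longrightarrow> a \<in> actions G h \<Longrightarrow> 0 \<le> chance_prob G h a"
    and chance_sum: "\<And>h. h \<in> decision_states G {chance G} \<Longrightarrow> (\<Sum>a\<in>actions G h. chance_prob G h a) = 1"

text \<open>A strategy of a single player maps an information set and an action to a probability;
  only its values at actions available in the states of the information set matter.\<close>

type_synonym 'a strategy = "'a list set \<Rightarrow> 'a \<Rightarrow> real"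

definition behaviour_strategy :: "('p, 'a) game \<Rightarrow> 'p \<Rightarrow> 'a strategy \<Rightarrow> bool" where
  "behaviour_strategy G q s \<longleftrightarrow>
     (\<forall>I\<in>info G q. \<forall>h\<in>I. (\<forall>a\<in>actions G h. 0 \<le> s I a) \<and> (\<Sum>a\<in>actions G h. s I a) = 1)"

definition info_set :: "('p, 'a) game \<Rightarrow> 'p \<Rightarrow> 'a list \<Rightarrow> 'a list set" where
  "info_set G q h = (THE I. I \<in> info G q \<and> h \<in> I)"

text \<open>Probability that \<open>q\<close>, playing \<open>s\<close>, chooses \<open>a\<close> at \<open>h\<close>.  The value \<open>0\<close> outside
  \<^term>\<open>actions G h\<close> is the extension of a strategy to the enlarged action sets
  (\<open>block_actions\<close> below).  For the chance player the argument \<open>s\<close> is ignored.\<close>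

definition action_prob :: "('p, 'a) game \<Rightarrow> 'p \<Rightarrow> 'a strategy \<Rightarrow> 'a list \<Rightarrow> 'a \<Rightarrow> real" where
  "action_prob G q s h a =
     (if a \<in> actions G h
      then if q = chance G then chance_prob G h a else s (info_set G q h) a
      else 0)"

definition reach :: "('p, 'a) game \<Rightarrow> ('p \<Rightarrow> 'a strategy) \<Rightarrow> 'a list \<Rightarrow> real" where
  "reach G \<sigma> h =
     (\<Prod>(h', a) \<in> {(h', a). prefix (h' @ [a]) h}. action_prob G (actor G h') (\<sigma> (actor G h')) h' a)"

definition reach_player :: "('p, 'a) game \<Rightarrow> 'p \<Rightarrow> 'a strategy \<Rightarrow> 'a list \<Rightarrow> real" where
  "reach_player G q s h =
     (\<Prod>(h', a) \<in> {(h', a). prefix (h' @ [a]) h \<and> actor G h' = q}. action_prob G q s h' a)"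

definition reach_players :: "('p, 'a) game \<Rightarrow> ('p \<Rightarrow> 'a strategy) \<Rightarrow> 'p set \<Rightarrow> 'a list \<Rightarrow> real" where
  "reach_players G \<sigma> T h = (\<Prod>q\<in>T. reach_player G q (\<sigma> q) h)"

definition expected_value ::
    "('p, 'a) game \<Rightarrow> ('p \<Rightarrow> 'a strategy) \<Rightarrow> ('a list \<Rightarrow> real) \<Rightarrow> real" where
  "expected_value G \<sigma> f = (\<Sum>z\<in>terminals G. reach G \<sigma> z * f z)"

definition block_actions :: "('p, 'a) game \<Rightarrow> 'a list set \<Rightarrow> 'a set" where
  "block_actions G H = (\<Union>h\<in>H. actions G h)"

text \<open>\<open>T\<close> is the set of players whose strategies are known.  The requirement on reach
  probabilities ranges over all behaviour strategies of the other players, not just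
  those of one profile.\<close>

definition admissible_partition ::
    "('p, 'a) game \<Rightarrow> 'p set \<Rightarrow> 'a list set set \<Rightarrow> bool" where
  "admissible_partition G T \<H> \<longleftrightarrow>
     partition_on (decision_states G T) \<H> \<and>
     (\<forall>H\<in>\<H>. \<forall>h\<in>H. \<forall>h'\<in>H.
        (\<forall>q \<in> players G - T. \<forall>s. behaviour_strategy G q s \<longrightarrow>
           reach_player G q s h = reach_player G q s h') \<and>
        \<not> strict_prefix h h')"

definition observed_action :: "('p, 'a) game \<Rightarrow> 'a list set \<Rightarrow> 'a list \<Rightarrow> 'a" where
  "observed_action G H z = (THE a. \<exists>h\<in>H. a \<in> actions G h \<and> prefix (h @ [a]) z)"

text \<open>For a terminal \<open>z\<close> passing through \<open>H\<close>, a denominator below can vanish only if \<open>z\<close>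
  has reach probability \<open>0\<close>, so the convention \<open>x / 0 = 0\<close> does not affect expectations.\<close>

definition correction ::
    "('p, 'a) game \<Rightarrow> ('p \<Rightarrow> 'a strategy) \<Rightarrow> 'p set \<Rightarrow> ('a list \<Rightarrow> 'a \<Rightarrow> real)
      \<Rightarrow> 'a list set \<Rightarrow> 'a list \<Rightarrow> real" where
  "correction G \<sigma> T u H z =
     (if \<exists>h\<in>H. strict_prefix h z then
        (let b = observed_action G H z in
          (\<Sum>a\<in>block_actions G H. \<Sum>h\<in>H. reach_players G \<sigma> T (h @ [a]) * u h a)
            / (\<Sum>h\<in>H. reach_players G \<sigma> T h)
          - (\<Sum>h\<in>H. reach_players G \<sigma> T (h @ [b]) * u h b)
            / (\<Sum>h\<in>H. reach_players G \<sigma> T (h @ [b])))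
      else 0)"

end

(*
  Fix a block H.  The terminals passing through H are split according to the state h of H and
  the action a with which they leave H; the correction term depends on a only.  The terminals
  below h @ [a] carry total probability reach (h @ [a]), which is the product of the
  contribution of the known players and a factor of the other players that is the same for all
  h in H.  Hence the expected correction is a multiple of
  \<Sum>a. D(a) * (X / \<Sum>a'. D(a') - Y(a) / D(a)) = X - \<Sum>a. Y(a) = 0, where D(a) and Y(a) are
  the denominator and the numerator of the second fraction and X = \<Sum>a. Y(a).
*)
theory Submission
  imports Defs
begin

section \<open>Prefixes of histories and recursion for reach probabilities\<close>

lemma prefix_append_singleton_set:
  "{(h', a'). prefix (h' @ [a']) (h @ [a])} = insert (h, a) {(h', a'). prefix (h' @ [a']) h}"
  by (auto simp: prefix_snoc)

lemma finite_prefix_pairs: "finite {(h', a). prefix (h' @ [a]) h}"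
proof (induction h rule: rev_induct)
  case (snoc a h)
  then show ?case by (simp only: prefix_append_singleton_set finite_insert)
qed auto

lemma append_singleton_not_prefix: "\<not> prefix (h @ [a]) h"
  by (auto simp: prefix_def)

lemma prefix_append_singleton_unique:
  assumes "prefix (h @ [a]) z" "prefix (h @ [b]) z"
  shows "a = b"
  using assms by (auto simp: prefix_def)

lemma strict_prefix_imp_append_singleton:
  assumes "strict_prefix h z"
  obtains a where "prefix (h @ [a]) z"
  using assms by (metis append_one_prefix prefix_length_less strict_prefix_def)

lemma reach_Nil [simp]: "reach G \<sigma> [] = 1"
  by (simp add: reach_def)

lemma reach_snoc:
  "reach G \<sigma> (h @ [a]) = action_prob G (actor G h) (\<sigma> (actor G h)) h a * reach G \<sigma> h"
  unfolding reach_def prefix_append_singleton_set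
  by (subst prod.insert) (auto simp: finite_prefix_pairs append_singleton_not_prefix)

lemma reach_player_Nil [simp]: "reach_player G q s [] = 1"
  by (simp add: reach_player_def)

lemma reach_player_snoc:
  "reach_player G q s (h @ [a]) =
     (if actor G h = q then action_prob G q s h a else 1) * reach_player G q s h"
proof -
  let ?S = "\<lambda>h. {(h', a). prefix (h' @ [a]) h \<and> actor G h' = q}"
  have eq: "?S (h @ [a]) = (if actor G h = q then insert (h, a) (?S h) else ?S h)"
    by (auto simp: prefix_snoc)
  have fin: "finite (?S h)"
    by (rule finite_subset[OF _ finite_prefix_pairs[of h]]) auto
  show ?thesis
    unfolding reach_player_def eq using fin
    by (auto simp: append_singleton_not_prefix)
qed

text \<open>Only the player acting at \<open>h\<close> gains a factor, so the product over
  \<open>T\<close> picks up at most one new term, and none if the actor lies outside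
  \<open>T\<close>.\<close>

lemma reach_players_snoc:
  assumes "finite T"
  shows "reach_players G \<sigma> T (h @ [a]) =
    (if actor G h \<in> T then action_prob G (actor G h) (\<sigma> (actor G h)) h a else 1)
      * reach_players G \<sigma> T h"
  using assms by (simp add: reach_players_def reach_player_snoc prod.distrib prod.delta)

section \<open>Structure of the game tree\<close>

context extensive_form_game
begin

lemma prefix_state:
  assumes "s \<in> states G" "prefix h s"
  shows "h \<in> states G"
  using assms by (induction s rule: rev_induct) (auto simp: prefix_snoc dest: prefix_closed)

text \<open>By prefix closure, an available action already makes \<open>h\<close> a state.\<close>

lemma nonterminal_iff: "h \<in> states G - terminals G \<longleftrightarrow> actions G h \<noteq> {}"
  by (auto simp: terminals_def actions_def dest: prefix_closed)

lemma finite_actions: "finite (actions G h)"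
proof -
  have "(\<lambda>a. h @ [a]) ` actions G h \<subseteq> states G" by (auto simp: actions_def)
  then have "finite ((\<lambda>a. h @ [a]) ` actions G h)" using finite_states finite_subset by blast
  then show ?thesis by (rule finite_imageD) (auto simp: inj_on_def)
qed

lemma finite_terminals: "finite (terminals G)"
  using finite_states by (auto simp: terminals_def)

text \<open>Since the information sets partition the decision states of \<open>q\<close>, exactly
  one contains \<open>h\<close>, so the definite description in \<open>info_set\<close> is
  meaningful.\<close>

lemma info_set_mem:
  assumes "q \<in> players G" "h \<in> decision_states G {q}"
  shows "info_set G q h \<in> info G q" "h \<in> info_set G q h"
proof -
  have "\<exists>!I. I \<in> info G q \<and> h \<in> I"
    using info_partition[OF assms(1)] assms(2) by (auto simp: partition_on_def disjoint_def)
  from theI'[OF this] show "info_set G q h \<in> info G q" "h \<in> info_set G q h"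
    by (auto simp: info_set_def)
qed

text \<open>A terminal below \<open>h\<close> differs from \<open>h\<close>, hence lies below some
  successor. This is the recursion step for sums over terminals.\<close>

lemma terminals_below_nonterminal:
  assumes "h \<in> states G - terminals G"
  shows "{z \<in> terminals G. prefix h z} =
    (\<Union>a\<in>actions G h. {z \<in> terminals G. prefix (h @ [a]) z})"
proof (intro equalityI subsetI)
  fix z assume z: "z \<in> {z \<in> terminals G. prefix h z}"
  then have "strict_prefix h z" using assms by (auto simp: strict_prefix_def)
  then obtain a where a: "prefix (h @ [a]) z" by (rule strict_prefix_imp_append_singleton)
  then have "a \<in> actions G h" using z prefix_state by (auto simp: actions_def terminals_def)
  with a z show "z \<in> (\<Union>a\<in>actions G h. {z \<in> terminals G. prefix (h @ [a]) z})" by auto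
qed (auto dest: append_prefixD)

lemma terminals_below_terminal:
  assumes "h \<in> terminals G"
  shows "{z \<in> terminals G. prefix h z} = {h}"
proof -
  have "z = h" if z: "z \<in> terminals G" "prefix h z" for z
  proof (rule ccontr)
    assume "z \<noteq> h"
    with z have "strict_prefix h z" by (auto simp: strict_prefix_def)
    then obtain a where "prefix (h @ [a]) z" by (rule strict_prefix_imp_append_singleton)
    then have "a \<in> actions G h" using z prefix_state by (auto simp: actions_def terminals_def)
    then show False using assms by (auto simp: terminals_def)
  qed
  then show ?thesis using assms by auto
qed

end

section \<open>Probabilities under a fixed strategy profile\<close>

locale game_with_profile = extensive_form_game G for G :: "('p, 'a) game" +
  fixes \<sigma> :: "'p \<Rightarrow> 'a strategy"
  assumes behaviour: "\<And>q. q \<in> players G \<Longrightarrow> behaviour_strategy G q (\<sigma> q)"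
begin

lemma action_prob_nonneg: "0 \<le> action_prob G (actor G h) (\<sigma> (actor G h)) h a"
proof (cases "a \<in> actions G h")
  case True
  then have h: "h \<in> states G - terminals G" using nonterminal_iff by blast
  show ?thesis
  proof (cases "actor G h = chance G")
    case True
    then show ?thesis using h \<open>a \<in> actions G h\<close> chance_nonneg[of h a]
      by (auto simp: action_prob_def decision_states_def)
  next
    case False
    then have q: "actor G h \<in> players G" using actor_mem[OF h] by auto
    have "h \<in> decision_states G {actor G h}" using h by (auto simp: decision_states_def)
    from info_set_mem[OF q this] show ?thesis using behaviour[OF q] False True
      by (auto simp: action_prob_def behaviour_strategy_def)
  qed
qed (simp add: action_prob_def)

lemma action_prob_sum:
  assumes h: "h \<in> states G - terminals G"
  shows "(\<Sum>a\<in>actions G h. action_prob G (actor G h) (\<sigma> (actor G h)) h a) = 1"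
proof (cases "actor G h = chance G")
  case True
  then show ?thesis using h chance_sum[of h]
    by (auto simp: action_prob_def decision_states_def)
next
  case False
  then have q: "actor G h \<in> players G" using actor_mem[OF h] by auto
  have "h \<in> decision_states G {actor G h}" using h by (auto simp: decision_states_def)
  from info_set_mem[OF q this] show ?thesis using behaviour[OF q] False
    by (auto simp: action_prob_def behaviour_strategy_def)
qed

lemma reach_players_nonneg: "0 \<le> reach_players G \<sigma> T h"
proof -
  have "0 \<le> reach_player G q (\<sigma> q) h" for q
    unfolding reach_player_def by (rule prod_nonneg) (use action_prob_nonneg in auto)
  then show ?thesis by (auto simp: reach_players_def intro: prod_nonneg)
qed

text \<open>As \<open>T\<close> contains the chance player, \<open>T\<close> and
  \<open>players G - T\<close> together cover every possible actor and are disjoint. Each move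
  therefore contributes its factor to exactly one of the two products.\<close>

lemma reach_factorization:
  assumes "h \<in> states G" "T \<subseteq> insert (chance G) (players G)" "chance G \<in> T"
  shows "reach G \<sigma> h = reach_players G \<sigma> T h * reach_players G \<sigma> (players G - T) h"
  using assms(1)
proof (induction h rule: rev_induct)
  case Nil
  then show ?case by (simp add: reach_players_def)
next
  case (snoc a h)
  then have h: "h \<in> states G" by (blast dest: prefix_closed)
  have "a \<in> actions G h" using snoc by (simp add: actions_def)
  then have "actor G h \<in> insert (chance G) (players G)"
    using actor_mem nonterminal_iff by blast
  moreover have "finite T" using assms(2) finite_players by (meson finite_insert finite_subset)
  ultimately show ?case
    using snoc.IH[OF h] assms finite_players by (auto simp: reach_snoc reach_players_snoc)
qed

lemma sum_reach_terminals_below: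
  assumes "h \<in> states G"
  shows "(\<Sum>z | z \<in> terminals G \<and> prefix h z. reach G \<sigma> z) = reach G \<sigma> h"
  using assms
\<comment> \<open>Induction on the size of the subtree at \<open>h\<close>: passing to a successor
  drops at least \<open>h\<close> itself. The mass is conserved at each nonterminal state because
  the action probabilities sum to 1.\<close>
proof (induction "card {s \<in> states G. prefix h s}" arbitrary: h rule: less_induct)
  case less
  show ?case
  proof (cases "h \<in> terminals G")
    case True
    then show ?thesis using terminals_below_terminal by simp
  next
    case False
    then have h: "h \<in> states G - terminals G" using less by simp
    have IH: "(\<Sum>z | z \<in> terminals G \<and> prefix (h @ [a]) z. reach G \<sigma> z) = reach G \<sigma> (h @ [a])"
      if "a \<in> actions G h" for a
    proof (rule less.hyps)
      have "{s \<in> states G. prefix (h @ [a]) s} \<subset> {s \<in> states G. prefix h s}"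
      proof (rule psubsetI)
        show "{s \<in> states G. prefix (h @ [a]) s} \<noteq> {s \<in> states G. prefix h s}"
          using less.prems append_singleton_not_prefix[of h a] by blast
      qed (auto dest: append_prefixD)
      then show "card {s \<in> states G. prefix (h @ [a]) s} < card {s \<in> states G. prefix h s}"
        using finite_states by (intro psubset_card_mono) auto
      show "h @ [a] \<in> states G" using that by (simp add: actions_def)
    qed
    have "(\<Sum>z | z \<in> terminals G \<and> prefix h z. reach G \<sigma> z) =
        (\<Sum>a\<in>actions G h. \<Sum>z | z \<in> terminals G \<and> prefix (h @ [a]) z. reach G \<sigma> z)"
      unfolding terminals_below_nonterminal[OF h]
      using finite_actions finite_terminals
      by (intro sum.UNION_disjoint) (auto dest: prefix_append_singleton_unique)
    also have "\<dots> = (\<Sum>a\<in>actions G h. action_prob G (actor G h) (\<sigma> (actor G h)) h a) * reach G \<sigma> h"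
      by (simp add: IH reach_snoc sum_distrib_right)
    also have "\<dots> = reach G \<sigma> h" by (simp add: action_prob_sum[OF h])
    finally show ?thesis .
  qed
qed

section \<open>Expected correction of a single block\<close>

lemma expected_correction_block:
  assumes T: "T \<subseteq> insert (chance G) (players G)" "chance G \<in> T"
    and H: "H \<subseteq> decision_states G T"
    and same_reach: "\<And>h h' q. h \<in> H \<Longrightarrow> h' \<in> H \<Longrightarrow> q \<in> players G - T \<Longrightarrow>
      reach_player G q (\<sigma> q) h = reach_player G q (\<sigma> q) h'"
    and antichain: "\<And>h h'. h \<in> H \<Longrightarrow> h' \<in> H \<Longrightarrow> \<not> strict_prefix h h'"
  shows "expected_value G \<sigma> (correction G \<sigma> T u H) = 0"
proof -
  define r where "r = reach_players G \<sigma> T"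
  define A where "A = block_actions G H"
  define D where "D a = (\<Sum>h\<in>H. r (h @ [a]))" for a
  define Y where "Y a = (\<Sum>h\<in>H. r (h @ [a]) * u h a)" for a
  define X where "X = (\<Sum>a\<in>A. Y a)"
  define R where "R = (\<Sum>h\<in>H. r h)"
  define K where "K a = X / R - Y a / D a" for a

  have finT: "finite T" using T(1) finite_players by (meson finite_insert finite_subset)
  have Hnt: "h \<in> states G - terminals G" "actor G h \<in> T" if "h \<in> H" for h
    using H that by (auto simp: decision_states_def)
  have finH: "finite H" using Hnt finite_states by (meson Diff_iff finite_subset subsetI)
  have finA: "finite A" using finH finite_actions by (auto simp: A_def block_actions_def)
  have r_nonneg: "0 \<le> r h" for h by (simp add: r_def reach_players_nonneg)
  have r_snoc: "r (h @ [a]) = action_prob G (actor G h) (\<sigma> (actor G h)) h a * r h"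
    if "h \<in> H" for h a
    using Hnt that finT by (simp add: r_def reach_players_snoc)
  have r_zero: "r (h @ [a]) = 0" if "h \<in> H" "a \<notin> actions G h" for h a
    using that by (simp add: r_snoc action_prob_def)
  \<comment> \<open>The added actions have weight 0, so each state's own action set can be traded
    for the common set \<open>A\<close>, whatever \<open>f\<close> is.\<close>
  have extend: "(\<Sum>a\<in>A. r (h @ [a]) * f a) = (\<Sum>a\<in>actions G h. r (h @ [a]) * f a)"
    if "h \<in> H" for h f
    using that finA r_zero
    by (intro sum.mono_neutral_right) (auto simp: A_def block_actions_def)

  \<comment> \<open>A known player acts at each \<open>h\<close> in \<open>H\<close>, so
    \<open>r\<close> splits there like a probability and its values at the successors add up to
    \<open>r h\<close>.\<close>
  have R_eq: "(\<Sum>a\<in>A. D a) = R"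
  proof -
    have "(\<Sum>a\<in>A. r (h @ [a])) = r h" if "h \<in> H" for h
    proof -
      have "(\<Sum>a\<in>A. r (h @ [a])) = (\<Sum>a\<in>actions G h. r (h @ [a]))"
        using extend[OF that, of "\<lambda>_. 1"] by simp
      also have "\<dots> = (\<Sum>a\<in>actions G h. action_prob G (actor G h) (\<sigma> (actor G h)) h a) * r h"
        by (simp add: r_snoc[OF that] sum_distrib_right)
      finally show ?thesis using action_prob_sum Hnt that by simp
    qed
    then show ?thesis unfolding D_def R_def by (subst sum.swap) simp
  qed
  \<comment> \<open>Zero denominators: the weights are nonnegative, so a vanishing sum kills each
    weight and with it the numerator. Hence \<open>D a * (Y a / D a) = Y a\<close> and, by
    \<open>X_zero\<close>, \<open>R * (X / R) = X\<close> hold even under division by 0.\<close>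
  have Y_zero: "Y a = 0" if "D a = 0" for a
  proof -
    have "r (h @ [a]) = 0" if "h \<in> H" for h
      using \<open>D a = 0\<close> that finH r_nonneg by (simp add: D_def sum_nonneg_eq_0_iff)
    then show ?thesis by (simp add: Y_def)
  qed
  have X_zero: "X = 0" if "R = 0"
  proof -
    have "D a = 0" if "a \<in> A" for a
      using \<open>R = 0\<close> that finA r_nonneg
      by (simp add: R_eq[symmetric] sum_nonneg_eq_0_iff D_def sum_nonneg)
    then show ?thesis by (simp add: X_def Y_zero)
  qed
  have DK: "(\<Sum>a\<in>A. D a * K a) = 0"
  proof -
    have "(\<Sum>a\<in>A. D a * K a) = (\<Sum>a\<in>A. D a * (X / R) - Y a)"
      using Y_zero by (intro sum.cong refl) (auto simp: K_def right_diff_distrib)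
    also have "\<dots> = R * (X / R) - X"
      by (simp only: sum_subtractf R_eq X_def flip: sum_distrib_right)
    also have "\<dots> = 0" using X_zero by auto
    finally show ?thesis .
  qed

  let ?below = "\<lambda>h a. {z \<in> terminals G. prefix (h @ [a]) z}"
  \<comment> \<open>Two prefixes of \<open>z\<close> are comparable, and the antichain condition
    forces them to coincide. This gives both uniqueness of the observed action and disjointness of
    the sets \<open>?below h a\<close>.\<close>
  have same: "h = h' \<and> a = a'"
    if h: "h \<in> H" "h' \<in> H" and z: "prefix (h @ [a]) z" "prefix (h' @ [a']) z" for h h' a a' z
  proof -
    have "prefix h z" "prefix h' z" using z by (auto dest: append_prefixD)
    then have "prefix h h' \<or> prefix h' h" using prefix_same_cases by blast
    then have "h = h'" using antichain h by (auto simp: strict_prefix_def)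
    then show ?thesis using z prefix_append_singleton_unique[of h a z a'] by simp
  qed
  have corr: "correction G \<sigma> T u H z = K a"
    if "h \<in> H" "a \<in> actions G h" "z \<in> ?below h a" for h a z
  proof -
    have "strict_prefix h z"
      using that append_singleton_not_prefix[of h a] by (auto simp: strict_prefix_def dest: append_prefixD)
    moreover have "observed_action G H z = a"
      unfolding observed_action_def
    proof (rule the_equality)
      show "\<exists>h\<in>H. a \<in> actions G h \<and> prefix (h @ [a]) z" using that by blast
      show "b = a" if "\<exists>h\<in>H. b \<in> actions G h \<and> prefix (h @ [b]) z" for b
      proof -
        from that obtain h' where "h' \<in> H" "prefix (h' @ [b]) z" by blast
        then show ?thesis using same[of h' h b z a] \<open>h \<in> H\<close> \<open>z \<in> ?below h a\<close> by simp
      qed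
    qed
    ultimately show ?thesis using that(1)
      by (auto simp: correction_def K_def X_def Y_def D_def R_def r_def A_def)
  qed
  \<comment> \<open>The common factor of the other players, read off at an arbitrary state of the
    block. For empty \<open>H\<close> the choice is arbitrary but harmless, as the factorization is
    claimed only for members of \<open>H\<close>.\<close>
  define c where "c = reach_players G \<sigma> (players G - T) (SOME h. h \<in> H)"
  have c: "reach G \<sigma> (h @ [a]) = c * r (h @ [a])" if h: "h \<in> H" and a: "a \<in> actions G h" for h a
  proof -
    have "(SOME h. h \<in> H) \<in> H" using h by (rule someI)
    from same_reach[OF h this] have "reach_players G \<sigma> (players G - T) h = c"
      unfolding c_def reach_players_def by (rule prod.cong[OF refl])
    \<comment> \<open>The move out of \<open>h\<close> belongs to a player in \<open>T\<close>, so
      the factor of the others is unchanged.\<close>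
    moreover have "reach_players G \<sigma> (players G - T) (h @ [a]) = reach_players G \<sigma> (players G - T) h"
      using Hnt(2)[OF h] finite_players by (simp add: reach_players_snoc)
    moreover have "h @ [a] \<in> states G" using a by (simp add: actions_def)
    ultimately show ?thesis using reach_factorization[OF _ T] by (simp add: r_def)
  qed

  have through: "{z \<in> terminals G. \<exists>h\<in>H. strict_prefix h z} =
      (\<Union>(h, a)\<in>Sigma H (actions G). ?below h a)"
  proof -
    \<comment> \<open>States of the block are nonterminal, so they never equal
      \<open>z\<close>.\<close>
    have "prefix h z \<longleftrightarrow> strict_prefix h z" if "h \<in> H" "z \<in> terminals G" for h z
      using Hnt(1)[OF that(1)] that(2) by (auto simp: strict_prefix_def)
    then have "{z \<in> terminals G. \<exists>h\<in>H. strict_prefix h z} = (\<Union>h\<in>H. {z \<in> terminals G. prefix h z})"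
      by auto
    also have "\<dots> = (\<Union>h\<in>H. \<Union>a\<in>actions G h. ?below h a)"
      using terminals_below_nonterminal[OF Hnt(1)] by simp
    finally show ?thesis by auto
  qed
  have "expected_value G \<sigma> (correction G \<sigma> T u H) =
      (\<Sum>z | z \<in> terminals G \<and> (\<exists>h\<in>H. strict_prefix h z). reach G \<sigma> z * correction G \<sigma> T u H z)"
    unfolding expected_value_def using finite_terminals
    by (intro sum.mono_neutral_right) (auto simp: correction_def)
  also have "\<dots> = (\<Sum>(h, a)\<in>Sigma H (actions G). \<Sum>z\<in>?below h a. reach G \<sigma> z * correction G \<sigma> T u H z)"
    unfolding through
    using finH finite_actions finite_terminals
    by (subst sum.UNION_disjoint) (auto dest: same simp: case_prod_unfold)
  also have "\<dots> = (\<Sum>(h, a)\<in>Sigma H (actions G). c * (r (h @ [a]) * K a))"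
  proof (intro sum.cong refl, clarify)
    fix h a assume ha: "h \<in> H" "a \<in> actions G h"
    have "(\<Sum>z\<in>?below h a. reach G \<sigma> z * correction G \<sigma> T u H z) = (\<Sum>z\<in>?below h a. reach G \<sigma> z) * K a"
      unfolding sum_distrib_right using corr[OF ha] by (intro sum.cong) auto
    also have "(\<Sum>z\<in>?below h a. reach G \<sigma> z) = c * r (h @ [a])"
      using ha sum_reach_terminals_below[of "h @ [a]"] c by (simp add: actions_def)
    finally show "(\<Sum>z\<in>?below h a. reach G \<sigma> z * correction G \<sigma> T u H z) = c * (r (h @ [a]) * K a)"
      by simp
  qed
  also have "\<dots> = c * (\<Sum>h\<in>H. \<Sum>a\<in>actions G h. r (h @ [a]) * K a)"
    using finH finite_actions by (simp add: sum.Sigma sum_distrib_left case_prod_unfold)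
  \<comment> \<open>Once the inner range no longer depends on \<open>h\<close>, the two sums can be
    exchanged, which collects the weights into \<open>D a\<close>.\<close>
  also have "(\<Sum>h\<in>H. \<Sum>a\<in>actions G h. r (h @ [a]) * K a) = (\<Sum>h\<in>H. \<Sum>a\<in>A. r (h @ [a]) * K a)"
    using extend by simp
  also have "\<dots> = (\<Sum>a\<in>A. D a * K a)"
    unfolding D_def sum_distrib_right by (rule sum.swap)
  finally show ?thesis using DK by simp
qed

end

section \<open>Summation over the blocks of the partition\<close>

theorem theorem1:
  fixes G :: "('p, 'a) game"
    and \<sigma> :: "'p \<Rightarrow> 'a strategy"
    and P\<^sub>a :: "'p set"
    and \<H> :: "'a list set set"
    and u :: "'a list \<Rightarrow> 'a \<Rightarrow> real"
  assumes "extensive_form_game G"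
    and "\<And>q. q \<in> players G \<Longrightarrow> behaviour_strategy G q (\<sigma> q)"
    and "P\<^sub>a \<noteq> {}"
    and "P\<^sub>a \<subseteq> insert (chance G) (players G)"
    and "chance G \<in> P\<^sub>a"
    and "admissible_partition G P\<^sub>a \<H>"
  shows "expected_value G \<sigma> (\<lambda>z. \<Sum>H\<in>\<H>. correction G \<sigma> P\<^sub>a u H z) = 0"
proof -
  interpret extensive_form_game G by fact
  interpret game_with_profile G \<sigma> by unfold_locales fact
  have part: "partition_on (decision_states G P\<^sub>a) \<H>"
    using assms(6) by (simp add: admissible_partition_def)
  have "expected_value G \<sigma> (correction G \<sigma> P\<^sub>a u H) = 0" if H: "H \<in> \<H>" for H
  proof (rule expected_correction_block)
    show "H \<subseteq> decision_states G P\<^sub>a" using part H by (auto simp: partition_on_def)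
    fix h h' assume h: "h \<in> H" "h' \<in> H"
    show "\<not> strict_prefix h h'"
      using assms(6) H h by (simp add: admissible_partition_def)
    show "reach_player G q (\<sigma> q) h = reach_player G q (\<sigma> q) h'" if "q \<in> players G - P\<^sub>a" for q
      \<comment> \<open>Admissibility speaks of all behaviour strategies of \<open>q\<close>; here
        it is instantiated at the one in the profile.\<close>
      using assms(2)[of q] assms(6) H h that unfolding admissible_partition_def by blast
  qed fact+
  moreover have "expected_value G \<sigma> (\<lambda>z. \<Sum>H\<in>\<H>. correction G \<sigma> P\<^sub>a u H z) =
      (\<Sum>H\<in>\<H>. expected_value G \<sigma> (correction G \<sigma> P\<^sub>a u H))"
    unfolding expected_value_def sum_distrib_left by (rule sum.swap)
  ultimately show ?thesis by simp
qed

end
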